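(* Let $0<q<p\le1$, let $k$ be a positive integer and $n\ge0$. Then $$\sum_{m=0}^nS_1(n,m,x)B_{m,p,q}^{(k)}(x)=\frac{n!}{[n+1]_{p,q}^k},\qquad \sum_{m=0}^nS_2(n,m,x)C_{m,p,q}^{(k)}(x)=\frac{1}{[n+1]_{p,q}^k},\qquad \sum_{m=0}^nS_2(n,m,-x)\widehat{C}_{m,p,q}^{(k)}(x)=\frac{(-1)^n}{[n+1]_{p,q}^k}.$$
   Context: $[n]_{p,q}=\frac{p^n-q^n}{p-q}$; $\mathrm{Li}_{k,p,q}(t)=\sum_{n\ge1} t^n/[n]_{p,q}^k$. The $(p,q)$-poly-Bernoulli polynomials: $\frac{\mathrm{Li}_{k,p,q}(1-e^{-t})}{1-e^{-t}}e^{-xt}=\sum_{n\ge0}B_{n,p,q}^{(k)}(x)\frac{t^n}{n!}$. For $0<q<p\le1$ the $(p,q)$-integral is $\int_0^x f(t)\,d_{p,q}t=(p-q)x\sum_{n\ge0} \frac{q^n}{p^{n+1}}f\!\left(\frac{q^n}{p^{n+1}}x\right)$. With $(y)_n=y(y-1)\cdots(y-n+1)$, $(y)_0=1$: $C_{n,p,q}^{(k)}(x)=\int_0^1\cdots\int_0^1 (t_1\cdots t_k-x)_n\,d_{p,q}t_1\cdots d_{p,q}t_k$ and $\widehat{C}_{n,p,q}^{(k)}(x)=\int_0^1\cdots\int_0^1 (-t_1\cdots t_k+x)_n\,d_{p,q}t_1\cdots d_{p,q}t_k$ ($k$-fold). Weighted Stirling numbers: $\frac{e^{xt}(e^t-1)^m}{m!}=\sum_{n\ge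 m}S_2(n,m,x)\frac{t^n}{n!}$ and $\frac{(1-t)^{-x}(-\ln(1-t))^m}{m!}=\sum_{n\ge m}S_1(n,m,x)\frac{t^n}{n!}$. *)

theory Defs
  imports Complex_Main "HOL-Computational_Algebra.Formal_Power_Series"
begin

definition pq_number :: "real \<Rightarrow> real \<Rightarrow> nat \<Rightarrow> real" where
  "pq_number p q n = (p ^ n - q ^ n) / (p - q)"

definition egf_coeff :: "real fps \<Rightarrow> nat \<Rightarrow> real" where
  "egf_coeff F n = fact n * fps_nth F n"

definition pq_polylog :: "nat \<Rightarrow> real \<Rightarrow> real \<Rightarrow> real fps" where
  "pq_polylog k p q = Abs_fps (\<lambda>n. if n = 0 then 0 else 1 / pq_number p q n ^ k)"

text \<open>Both series in the quotient below have zero constant term and the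
  denominator has nonzero linear term, so the library's division of formal power
  series is the exact quotient.\<close>

definition pq_poly_bernoulli :: "nat \<Rightarrow> real \<Rightarrow> real \<Rightarrow> nat \<Rightarrow> real \<Rightarrow> real" where
  "pq_poly_bernoulli k p q n x =
     egf_coeff (fps_compose (pq_polylog k p q) (1 - fps_exp (-1)) / (1 - fps_exp (-1))
                * fps_exp (- x)) n"

definition pq_integral :: "real \<Rightarrow> real \<Rightarrow> (real \<Rightarrow> real) \<Rightarrow> real \<Rightarrow> real" where
  "pq_integral p q f x =
     (p - q) * x * (\<Sum>n. q ^ n / p ^ (n + 1) * f (q ^ n / p ^ (n + 1) * x))"

text \<open>The \<open>k\<close>-fold integral over \<open>[0, 1]\<close> of a function of the list
  \<open>[t\<^sub>1, \<dots>, t\<^sub>k]\<close>; the variable \<open>t\<^sub>1\<close> is integrated first.\<close>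

primrec pq_multi_integral :: "real \<Rightarrow> real \<Rightarrow> nat \<Rightarrow> (real list \<Rightarrow> real) \<Rightarrow> real" where
  "pq_multi_integral p q 0 f = f []"
| "pq_multi_integral p q (Suc k) f =
     pq_integral p q (\<lambda>t. pq_multi_integral p q k (\<lambda>ts. f (ts @ [t]))) 1"

definition falling_factorial :: "real \<Rightarrow> nat \<Rightarrow> real" where
  "falling_factorial y n = (\<Prod>i<n. y - real i)"

definition pq_poly_cauchy1 :: "nat \<Rightarrow> real \<Rightarrow> real \<Rightarrow> nat \<Rightarrow> real \<Rightarrow> real" where
  "pq_poly_cauchy1 k p q n x =
     pq_multi_integral p q k (\<lambda>ts. falling_factorial (prod_list ts - x) n)"

definition pq_poly_cauchy2 :: "nat \<Rightarrow> real \<Rightarrow> real \<Rightarrow> nat \<Rightarrow> real \<Rightarrow> real" where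
  "pq_poly_cauchy2 k p q n x =
     pq_multi_integral p q k (\<lambda>ts. falling_factorial (- prod_list ts + x) n)"

definition weighted_stirling2 :: "nat \<Rightarrow> nat \<Rightarrow> real \<Rightarrow> real" where
  "weighted_stirling2 n m x =
     egf_coeff (fps_const (1 / fact m) * (fps_exp x * (fps_exp 1 - 1) ^ m)) n"

text \<open>\<open>fps_binomial a\<close> is \<open>(1 + X)\<^sup>a\<close> and \<open>fps_ln 1\<close> is \<open>ln (1 + X)\<close>; composing
  with \<open>- X\<close> gives \<open>(1 - X)\<^sup>a\<close> and \<open>ln (1 - X)\<close>.\<close>

definition weighted_stirling1 :: "nat \<Rightarrow> nat \<Rightarrow> real \<Rightarrow> real" where
  "weighted_stirling1 n m x =
     egf_coeff (fps_const (1 / fact m) *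
       (fps_compose (fps_binomial (- x)) (- fps_X) * (- fps_compose (fps_ln 1) (- fps_X)) ^ m)) n"

end

theory Submission
  imports Defs "HOL-Computational_Algebra.Polynomial"
begin

unbundle fps_syntax

text \<open>
  Writing \<open>G\<close> for the exponential generating function of a sequence \<open>a\<close>, the sums
  \<open>\<Sum>m. S\<^sub>1(n,m,x) a\<^sub>m\<close> and \<open>\<Sum>m. S\<^sub>2(n,m,x) a\<^sub>m\<close> are the exponential coefficients of
  \<open>(1 - X)\<^sup>-\<^sup>x \<cdot> G(- ln (1 - X))\<close> and \<open>e\<^sup>x\<^sup>X \<cdot> G(e\<^sup>X - 1)\<close>. For the poly-Bernoulli
  polynomials the substitution turns \<open>1 - e\<^sup>-\<^sup>X\<close> into \<open>X\<close> and \<open>e\<^sup>-\<^sup>x\<^sup>X\<close> into \<open>(1 - X)\<^sup>x\<close>, so that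
  only \<open>Li(X) / X\<close> remains. For \<open>a\<^sub>m = (y - x)\<^sub>m\<close> the second series is \<open>e\<^sup>y\<^sup>X\<close>, so that
  \<open>\<Sum>m. S\<^sub>2(n,m,x) (y - x)\<^sub>m = y\<^sup>n\<close>; one then integrates this polynomial identity with
  \<open>y = \<plusminus> t\<^sub>1 \<cdots> t\<^sub>k\<close>, using that the moments of the \<open>(p,q)\<close>-integral
  are \<open>1 / [n+1]\<^sub>p\<^sub>,\<^sub>q\<close>.
\<close>

lemma fps_mult_compose_nth:
  fixes A G L :: "'a::comm_ring_1 fps"
  assumes "L $ 0 = 0"
  shows "(A * (G oo L)) $ n = (\<Sum>m=0..n. G $ m * (A * L ^ m) $ n)"
proof -
  \<comment> \<open>As \<open>L ^ m\<close> has no terms below degree \<open>m\<close>, the bound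
    \<open>n - j\<close> may be raised to \<open>n\<close>; a bound free of \<open>j\<close> allows
    the swap of sums.\<close>
  have "(G oo L) $ (n - j) = (\<Sum>m=0..n. G $ m * L ^ m $ (n - j))" for j
    unfolding fps_compose_nth
    by (rule sum.mono_neutral_left)
      (use startsby_zero_power_prefix[OF assms] in auto)
  then have "(A * (G oo L)) $ n = (\<Sum>j=0..n. \<Sum>m=0..n. G $ m * (A $ j * L ^ m $ (n - j)))"
    by (simp add: fps_mult_nth sum_distrib_left mult_ac)
  also have "\<dots> = (\<Sum>m=0..n. G $ m * (A * L ^ m) $ n)"
    by (subst sum.swap) (simp add: fps_mult_nth sum_distrib_left)
  finally show ?thesis .
qed

lemma egf_coeff_mult_compose:
  assumes "L $ 0 = 0"
  shows "(\<Sum>m=0..n. egf_coeff (fps_const (1 / fact m) * (A * L ^ m)) n * egf_coeff G m)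
           = egf_coeff (A * (G oo L)) n"
  unfolding egf_coeff_def fps_mult_compose_nth[OF assms] sum_distrib_left
  by (rule sum.cong) auto

text \<open>Both sides solve \<open>F' = a F / (1 + X)\<close> with constant term 1.\<close>

lemma fps_exp_compose_fps_ln:
  fixes a :: "'a::field_char_0"
  shows "fps_exp a oo fps_ln 1 = fps_binomial a"
proof -
  have "fps_deriv (fps_exp a oo fps_ln 1)
      = fps_const a * (fps_exp a oo fps_ln 1) / (1 + fps_X)"
    by (simp add: fps_compose_deriv fps_ln_deriv fps_compose_mult_distrib fps_divide_unit)
  then show ?thesis
    by (simp flip: fps_binomial_ODE_unique')
qed

lemma fps_binomial_compose_fps_exp:
  fixes a :: "'a::field_char_0"
  shows "fps_binomial a oo (fps_exp 1 - 1) = fps_exp a"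
proof -
  have "fps_binomial a oo (fps_exp 1 - 1) = fps_exp a oo (fps_ln 1 oo (fps_exp 1 - 1))"
    by (simp add: fps_exp_compose_fps_ln fps_compose_assoc)
  also have "\<dots> = fps_exp a"
    by (simp add: fps_ln_fps_exp_inv fps_inv_fps_exp_compose)
  finally show ?thesis .
qed

lemma fps_exp_compose_neg_ln_neg:
  fixes a :: "'a::field_char_0"
  shows "fps_exp a oo (- (fps_ln 1 oo - fps_X)) = fps_binomial (- a) oo - fps_X"
proof -
  \<comment> \<open>The outer sign becomes a left composition with \<open>- X\<close>, which
    associativity moves onto \<open>fps_exp a\<close>.\<close>
  have "- (fps_ln 1 oo - fps_X) = - fps_X oo (fps_ln 1 oo (- fps_X :: 'a fps))"
    by (simp add: fps_compose_uminus fps_X_fps_compose_startby0)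
  then have "fps_exp a oo (- (fps_ln 1 oo - fps_X))
      = (fps_exp a oo - fps_X) oo (fps_ln 1 oo - fps_X)"
    by (simp add: fps_compose_assoc del: fps_fps_exp_compose_minus)
  also have "\<dots> = fps_binomial (- a) oo - fps_X"
    by (simp add: fps_compose_assoc fps_exp_compose_fps_ln)
  finally show ?thesis .
qed

lemma weighted_stirling1_poly_bernoulli_sum:
  "(\<Sum>m=0..n. weighted_stirling1 n m x * pq_poly_bernoulli k p q m x)
     = fact n / pq_number p q (n + 1) ^ k"
proof -
  define U :: "real fps" where "U = 1 - fps_exp (- 1)"
  define L :: "real fps" where "L = - (fps_ln 1 oo - fps_X)"
  define M where "M = Abs_fps (\<lambda>n. 1 / pq_number p q (n + 1) ^ k)"
  define G where "G = (pq_polylog k p q oo U) / U * fps_exp (- x)"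
  have L0: "L $ 0 = 0" and U0: "U $ 0 = 0"
    by (simp_all add: L_def U_def)
  have "U $ 1 \<noteq> 0"
    by (simp add: U_def)
  then have "U \<noteq> 0"
    by auto
  \<comment> \<open>Splitting off \<open>X\<close> leaves a factor \<open>U\<close> after
    substitution, which cancels the denominator of \<open>G\<close>; the index shift yields the
    \<open>n + 1\<close> of the result.\<close>
  have "pq_polylog k p q = fps_X * M"
    by (auto simp: pq_polylog_def M_def fps_eq_iff)
  then have "pq_polylog k p q oo U = U * (M oo U)"
    by (simp add: fps_compose_mult_distrib U0 fps_X_fps_compose_startby0)
  with \<open>U \<noteq> 0\<close> have G: "G = (M oo U) * fps_exp (- x)"
    by (simp add: G_def)
  have "U oo L = 1 - (fps_binomial 1 oo - fps_X)"
    by (simp add: U_def L_def fps_compose_sub_distrib fps_exp_compose_neg_ln_neg)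
  also have "\<dots> = fps_X"
    by (simp add: fps_binomial_1 fps_compose_add_distrib fps_X_fps_compose_startby0)
  finally have "(M oo U) oo L = M"
    by (simp flip: fps_compose_assoc[OF L0 U0])
  then have "G oo L = M * (fps_binomial x oo - fps_X)"
    by (simp add: G fps_compose_mult_distrib L0) (simp add: L_def fps_exp_compose_neg_ln_neg)
  moreover have "(fps_binomial (- x) oo - fps_X) * (fps_binomial x oo - fps_X) = 1"
    by (simp flip: fps_compose_mult_distrib fps_binomial_add_mult)
  ultimately have "(fps_binomial (- x) oo - fps_X) * (G oo L) = M"
    by (simp add: mult.left_commute)
  moreover have "(\<Sum>m=0..n. weighted_stirling1 n m x * pq_poly_bernoulli k p q m x)
      = egf_coeff ((fps_binomial (- x) oo - fps_X) * (G oo L)) n"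
    unfolding egf_coeff_mult_compose[OF L0, symmetric]
    by (simp add: weighted_stirling1_def pq_poly_bernoulli_def G_def U_def L_def)
  ultimately show ?thesis
    by (simp add: egf_coeff_def M_def)
qed

lemma weighted_stirling2_falling_factorial_sum:
  "(\<Sum>m=0..n. weighted_stirling2 n m x * falling_factorial (y - x) m) = y ^ n"
proof -
  have "falling_factorial (y - x) m = egf_coeff (fps_binomial (y - x)) m" for m
    by (simp add: falling_factorial_def egf_coeff_def gbinomial_mult_fact atLeast0LessThan)
  then have "(\<Sum>m=0..n. weighted_stirling2 n m x * falling_factorial (y - x) m)
      = egf_coeff (fps_exp x * (fps_binomial (y - x) oo (fps_exp 1 - 1))) n"
    by (simp add: weighted_stirling2_def egf_coeff_mult_compose)
  also have "fps_exp x * (fps_binomial (y - x) oo (fps_exp 1 - 1)) = fps_exp y"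
    by (simp add: fps_binomial_compose_fps_exp flip: fps_exp_add_mult)
  finally show ?thesis
    by (simp add: egf_coeff_def)
qed

text \<open>A geometric series of ratio \<open>(q / p) ^ (i + 1)\<close>. The prefactor
  \<open>p - q\<close> of the integral turns its sum into
  \<open>1 / pq_number p q (i + 1)\<close>.\<close>

lemma pq_moment_sums:
  fixes p q :: real
  assumes "0 < q" "q < p"
  shows "(\<lambda>j. q ^ j / p ^ (j + 1) * (q ^ j / p ^ (j + 1)) ^ i)
           sums (1 / (p ^ (i + 1) - q ^ (i + 1)))"
proof -
  define r where "r = (q / p) ^ (i + 1)"
  have "p > 0"
    using assms by linarith
  have "norm r < 1"
    using assms power_strict_mono[of "q / p" 1 "i + 1"] by (simp add: r_def)
  then have "(\<lambda>j. r ^ j / p ^ (i + 1)) sums (1 / (1 - r) / p ^ (i + 1))"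
    by (intro sums_divide geometric_sums)
  moreover have "r ^ j / p ^ (i + 1) = q ^ j / p ^ (j + 1) * (q ^ j / p ^ (j + 1)) ^ i" for j
  proof -
    have "q ^ j / p ^ (j + 1) * (q ^ j / p ^ (j + 1)) ^ i = (q ^ j / p ^ (j + 1)) ^ (i + 1)"
      by simp
    also have "\<dots> = ((q / p) ^ j / p) ^ (i + 1)"
      by (simp add: power_divide mult.commute)
    also have "\<dots> = ((q / p) ^ j) ^ (i + 1) / p ^ (i + 1)"
      by (rule power_divide)
    also have "\<dots> = r ^ j / p ^ (i + 1)"
      unfolding r_def power_mult[symmetric] by (simp only: mult.commute)
    finally show ?thesis ..
  qed
  moreover have "1 / (1 - r) / p ^ (i + 1) = 1 / (p ^ (i + 1) - q ^ (i + 1))"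
    using \<open>p > 0\<close> by (simp add: r_def power_divide left_diff_distrib)
  ultimately show ?thesis
    by simp
qed

text \<open>Exchanging the finite sum with the series is justified by the convergence of each moment
  series.\<close>

lemma pq_integral_polynomial:
  assumes "0 < q" "q < p"
  shows "pq_integral p q (\<lambda>t. \<Sum>i\<le>d. a i * t ^ i) 1 = (\<Sum>i\<le>d. a i / pq_number p q (i + 1))"
proof -
  have "(\<lambda>j. \<Sum>i\<le>d. a i * (q ^ j / p ^ (j + 1) * (q ^ j / p ^ (j + 1)) ^ i))
      sums (\<Sum>i\<le>d. a i * (1 / (p ^ (i + 1) - q ^ (i + 1))))"
    by (intro sums_sum sums_mult pq_moment_sums assms)
  then have "(\<Sum>j. q ^ j / p ^ (j + 1) * (\<Sum>i\<le>d. a i * (q ^ j / p ^ (j + 1)) ^ i))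
      = (\<Sum>i\<le>d. a i * (1 / (p ^ (i + 1) - q ^ (i + 1))))"
    by (intro sums_unique[symmetric]) (simp only: sum_distrib_left mult.left_commute)
  then show ?thesis
    unfolding pq_integral_def
    by (simp add: pq_number_def sum_distrib_left mult.commute)
qed

lemma pq_multi_integral_polynomial:
  assumes "0 < q" "q < p"
  shows "pq_multi_integral p q k (\<lambda>ts. \<Sum>i\<le>d. a i * prod_list ts ^ i)
           = (\<Sum>i\<le>d. a i / pq_number p q (i + 1) ^ k)"
proof (induction k arbitrary: a)
  case 0
  then show ?case by simp
next
  case (Suc k)
  \<comment> \<open>For fixed \<open>t\<close>, the power \<open>t ^ i\<close> is absorbed into the
    coefficient, hence the induction over arbitrary \<open>a\<close>.\<close>
  have "pq_multi_integral p q k (\<lambda>ts. \<Sum>i\<le>d. a i * prod_list (ts @ [t]) ^ i)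
      = (\<Sum>i\<le>d. a i / pq_number p q (i + 1) ^ k * t ^ i)" for t
    using Suc.IH[of "\<lambda>i. a i * t ^ i"] by (simp add: power_mult_distrib mult_ac)
  then show ?case
    using pq_integral_polynomial[OF assms, of "\<lambda>i. a i / pq_number p q (i + 1) ^ k" d]
    by (simp add: mult_ac)
qed

text \<open>The free bound \<open>d\<close> gives polynomials of different degrees a common
  summation range.\<close>

lemma pq_multi_integral_poly:
  assumes "0 < q" "q < p" "degree P \<le> d"
  shows "pq_multi_integral p q k (\<lambda>ts. poly P (prod_list ts))
           = (\<Sum>i\<le>d. coeff P i / pq_number p q (i + 1) ^ k)"
proof -
  have "poly P y = (\<Sum>i\<le>d. coeff P i * y ^ i)" for y
    unfolding poly_altdef using assms(3)
    by (intro sum.mono_neutral_left) (auto simp: coeff_eq_0)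
  then show ?thesis
    by (simp add: pq_multi_integral_polynomial[OF assms(1,2)])
qed

text \<open>Covers both kinds of Cauchy polynomials: \<open>c = 1\<close> gives the first,
  \<open>c = - 1\<close> with \<open>- x\<close> for \<open>x\<close> the second.\<close>

lemma weighted_stirling2_poly_cauchy_sum:
  assumes "0 < q" "q < p"
  shows "(\<Sum>m=0..n. weighted_stirling2 n m x *
            pq_multi_integral p q k (\<lambda>ts. falling_factorial (c * prod_list ts - x) m))
           = c ^ n / pq_number p q (n + 1) ^ k"
proof -
  define P where "P m = (\<Prod>i<m. [:- x - real i, c:])" for m
  define s where "s m = weighted_stirling2 n m x" for m
  have ff: "falling_factorial (c * y - x) m = poly (P m) y" for y m
    by (simp add: falling_factorial_def P_def poly_prod algebra_simps)
  have deg: "degree (P m) \<le> n" if "m \<le> n" for m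
  proof -
    have "degree (P m) \<le> (\<Sum>i<m. degree [:- x - real i, c:])"
      unfolding P_def
      by (rule order_trans[OF degree_prod_sum_le]) (simp_all only: o_def finite_lessThan order_refl)
    also have "\<dots> \<le> (\<Sum>i<m. 1)"
      by (intro sum_mono) simp
    finally show ?thesis
      using that by simp
  qed
  \<comment> \<open>The Stirling identity at \<open>c * y\<close> holds for every real
    \<open>y\<close>, so it is an identity of polynomials and coefficients may be compared.\<close>
  have "poly (\<Sum>m=0..n. smult (s m) (P m)) = poly (monom (c ^ n) n)"
    using weighted_stirling2_falling_factorial_sum[of n x "c * y" for y]
    by (simp add: fun_eq_iff poly_sum poly_monom s_def ff power_mult_distrib)
  then have sum_P: "(\<Sum>m=0..n. smult (s m) (P m)) = monom (c ^ n) n"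
    by (simp only: poly_eq_poly_eq_iff)
  have "(\<Sum>m=0..n. s m * pq_multi_integral p q k (\<lambda>ts. poly (P m) (prod_list ts)))
      = (\<Sum>m=0..n. s m * (\<Sum>i\<le>n. coeff (P m) i / pq_number p q (i + 1) ^ k))"
    by (simp add: pq_multi_integral_poly[OF assms deg])
  also have "\<dots> = (\<Sum>i\<le>n. coeff (\<Sum>m=0..n. smult (s m) (P m)) i / pq_number p q (i + 1) ^ k)"
    by (simp add: coeff_sum sum_distrib_left sum_divide_distrib) (rule sum.swap)
  also have "\<dots> = c ^ n / pq_number p q (n + 1) ^ k"
    unfolding sum_P by (simp add: if_distrib[of "\<lambda>u. u / _"] cong: if_cong)
  finally show ?thesis
    by (simp only: ff s_def)
qed

theorem theorem13:
  fixes p q x :: real and k n :: nat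
  assumes "0 < q" and "q < p" and "p \<le> 1" and "k \<ge> 1"
  shows "(\<Sum>m=0..n. weighted_stirling1 n m x * pq_poly_bernoulli k p q m x)
           = fact n / pq_number p q (n + 1) ^ k
       \<and> (\<Sum>m=0..n. weighted_stirling2 n m x * pq_poly_cauchy1 k p q m x)
           = 1 / pq_number p q (n + 1) ^ k
       \<and> (\<Sum>m=0..n. weighted_stirling2 n m (- x) * pq_poly_cauchy2 k p q m x)
           = (- 1) ^ n / pq_number p q (n + 1) ^ k"
  using weighted_stirling1_poly_bernoulli_sum[of n x k p q]
    weighted_stirling2_poly_cauchy_sum[OF assms(1,2), of n x k 1]
    weighted_stirling2_poly_cauchy_sum[OF assms(1,2), of n "- x" k "- 1"]
  by (simp add: pq_poly_cauchy1_def pq_poly_cauchy2_def)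

end
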